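(* Let $1\le I<N$ and suppose $k>I$ (with $k\le N$). For $1\le J\le I+1$ let $$\dot\sigma_J(k)=\binom{N}{J-1}\frac{(N-J)!}{(k-J)!},\qquad \dot\tau^\circ_J(k)=\dot\sigma_J(k)\sum_{i=k-J+1}^{N-J}\frac1i .$$ Then the dot products (over $J$) of $\dot\sigma_J(k)$ and of $\dot\tau^\circ_J(k)$ with $\dot R_J(x)$ yield the same polynomials as $N!$ times the dot products of $\sigma_J(k,j)$ and of $\tau^\circ_J(k,j)$, respectively, with $R_J(x)$. That is, for every $1\le j\le I+1$, $$\sum_{J=1}^{j}\dot\sigma_J(k)\,\dot R_J(x)=N!\sum_{J=1}^{I+1}\sigma_J(k,j)\,R_J(x)\quad\text{and}\quad \sum_{J=1}^{j}\dot\tau^\circ_J(k)\,\dot R_J(x)=N!\sum_{J=1}^{I+1}\tau^\circ_J(k,j)\,R_J(x).$$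
   Context: For $1\le J\le I+1$: $$R_J(x)=\frac{1}{N!\,(1-x)^{N-I}}\sum_{h=0}^{J-1}\binom Nh x^h(1-x)^{N-h},\qquad \dot R_J(x)=x^{J-1}(1-x)^{I-(J-1)}.$$ These are polynomials in $x$. Empty sums are $0$. Permutations are written as words; $\pi_i$ is the value in position $i$. A bottom-to-top maximum of a permutation is an entry whose position is to the right of the positions of all entries with smaller value. For a permutation $\pi$ of size greater than $I$, the $J$-statistic $J(\pi)$ is the value of the next (leftmost) bottom-to-top maximum in a position greater than $I$; it lies in $\{1,\dots,I+1\}$. The flattening of a sequence of $i$ distinct integers is the permutation in $\mathfrak{S}_i$ with the same relative order. A left-to-right maximum is an entry larger than all entries to its left. For a prefix $p\in\mathfrak{S}_k$, $\pi\in\mathfrak{S}_N$ is $p$-acceptable if the flattening of $\pi_1\cdots\pi_k$ equals $p$ and $\pi_k=N$. It is $p$-rejectable if the flattening of $\pi_1\cdots\pi_k$ equals $p$, the value $N$ lies in a position greater than $k$, and there are no left-to-right maxima of $\pi$ in positions strictly between $k$ and the position of $N$. For $k>I$: $\sigma_J(k,j)$ is the number of $\pi\in\mathfrak{S}_N$ with $J(\pi)=J$ that are $p$-acceptable for a prefix $p$ (ending in its largest value $k$) of size $k$ and $J$-statistic $j$. Its values, for all $1\le j\le I+1$, are given by the closed formula: $\sigma_J(k,j)=\frac{(N-k)(N-J-1)!}{(k-J)!}$ if $J<j$ (read as $0$ when $k=N$), $\sigma_j(k,j)=\frac{(N-j)!}{(k-j)!}$, and $\sigma_J(k,j)=0$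 if $J>j$; these formula values are used also for $k=I+1$, $j\le I$, where no such prefix ending in its largest value exists. $\tau^\circ_J(k,j)$ is the number of $\pi\in\mathfrak{S}_N$ with $J(\pi)=J$ that are $p$-rejectable for a prefix $p$ of size $k$ and $J$-statistic $j$. These counts do not depend on which such $p$ is chosen. *)

theory Defs
  imports
    Complex_Main
    "HOL-Combinatorics.Multiset_Permutations"
    "HOL-Computational_Algebra.Polynomial"
begin

(* A permutation of size n is a word, i.e. an element of permutations_of_set {1..n}: a distinct
   list with set {1..n}. List indices start at 0, so the entry in position i is \<pi> ! (i - 1), and
   "position greater than I" reads "index at least I". Index arguments (as opposed to values)
   below are always 0-based list indices. *)

abbreviation Sym :: "nat \<Rightarrow> nat list set" where
  "Sym n \<equiv> permutations_of_set {1..n}"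

definition flatten :: "nat list \<Rightarrow> nat list" where
  "flatten s = (THE p. p \<in> Sym (length s) \<and>
     (\<forall>a<length s. \<forall>b<length s. p ! a < p ! b \<longleftrightarrow> s ! a < s ! b))"

definition left_to_right_max :: "nat list \<Rightarrow> nat \<Rightarrow> bool" where
  "left_to_right_max \<pi> i \<longleftrightarrow> i < length \<pi> \<and> (\<forall>a<i. \<pi> ! a < \<pi> ! i)"

definition bottom_to_top_max :: "nat list \<Rightarrow> nat \<Rightarrow> bool" where
  "bottom_to_top_max \<pi> i \<longleftrightarrow> i < length \<pi> \<and> (\<forall>a<length \<pi>. \<pi> ! a < \<pi> ! i \<longrightarrow> a < i)"

definition J_stat :: "nat \<Rightarrow> nat list \<Rightarrow> nat" where
  "J_stat I \<pi> = \<pi> ! (LEAST i. I \<le> i \<and> bottom_to_top_max \<pi> i)"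

definition acceptable :: "nat \<Rightarrow> nat list \<Rightarrow> nat list \<Rightarrow> bool" where
  "acceptable N p \<pi> \<longleftrightarrow> flatten (take (length p) \<pi>) = p \<and> \<pi> ! (length p - 1) = N"

definition rejectable :: "nat \<Rightarrow> nat list \<Rightarrow> nat list \<Rightarrow> bool" where
  "rejectable N p \<pi> \<longleftrightarrow> flatten (take (length p) \<pi>) = p \<and>
     (\<exists>m<N. length p \<le> m \<and> \<pi> ! m = N \<and>
        (\<forall>i. length p \<le> i \<and> i < m \<longrightarrow> \<not> left_to_right_max \<pi> i))"

definition prefixes :: "nat \<Rightarrow> nat \<Rightarrow> nat \<Rightarrow> nat list set" where
  "prefixes I k j = {p \<in> Sym k. J_stat I p = j}"

(* sigma and tau are the common value, over all admissible prefixes p, of the number of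
   acceptable (rejectable) permutations: THE can only be evaluated by showing that the
   count does not depend on p. *)

(* For k = I + 1 and j \<le> I there is no prefix ending in its largest value, and sigma is given its
   values by convention. In the first case of the formula J < j \<le> I + 1 \<le> k, N holds in
   the range of interest, so the natural subtractions are exact; the value is 0 for k = N. *)
definition sigma :: "nat \<Rightarrow> nat \<Rightarrow> nat \<Rightarrow> nat \<Rightarrow> nat \<Rightarrow> real" where
  "sigma N I J k j =
     (if k = I + 1 \<and> j \<le> I then
        (if J < j then real (N - k) * fact (N - J - 1) / fact (k - J)
         else if J = j then fact (N - j) / fact (k - j)
         else 0)
      else real (THE n. \<forall>p\<in>{p \<in> prefixes I k j. last p = k}.
        n = card {\<pi> \<in> Sym N. J_stat I \<pi> = J \<and> acceptable N p \<pi>}))"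

definition tau :: "nat \<Rightarrow> nat \<Rightarrow> nat \<Rightarrow> nat \<Rightarrow> nat \<Rightarrow> real" where
  "tau N I J k j =
     real (THE n. \<forall>p\<in>prefixes I k j.
       n = card {\<pi> \<in> Sym N. J_stat I \<pi> = J \<and> rejectable N p \<pi>})"

(* In the polynomials below, [:0, 1:] is x and [:1, -1:] is 1 - x. *)

definition R_poly :: "nat \<Rightarrow> nat \<Rightarrow> nat \<Rightarrow> real poly" where
  "R_poly N I J =
     smult (1 / fact N)
       ((\<Sum>h<J. smult (real (N choose h)) ([:0, 1:] ^ h * [:1, -1:] ^ (N - h)))
          div [:1, -1:] ^ (N - I))"

(* The polynomial division in R_poly is exact. *)
lemma R_poly_exact:
  assumes "J \<le> I + 1"
  shows "[:1, -1:] ^ (N - I) dvd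
    (\<Sum>h<J. smult (real (N choose h)) ([:0, 1:] ^ h * [:1, -1:] ^ (N - h)))"
proof (intro dvd_sum dvd_smult dvd_mult le_imp_power_dvd)
  fix h assume "h \<in> {..<J}"
  with assms show "N - I \<le> N - h" by auto
qed

definition R_dot :: "nat \<Rightarrow> nat \<Rightarrow> real poly" where
  "R_dot I J = [:0, 1:] ^ (J - 1) * [:1, -1:] ^ (I - (J - 1))"

definition sigma_dot :: "nat \<Rightarrow> nat \<Rightarrow> nat \<Rightarrow> real" where
  "sigma_dot N J k = real (N choose (J - 1)) * (fact (N - J) / fact (k - J))"

definition tau_dot :: "nat \<Rightarrow> nat \<Rightarrow> nat \<Rightarrow> real" where
  "tau_dot N J k = sigma_dot N J k * (\<Sum>i = k - J + 1..N - J. 1 / real i)"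

end

theory Submission
  imports Defs
begin

text \<open>
  The J-statistic of a permutation is the least value missing from its first \<open>I\<close> entries, so it is
  at least \<open>J\<close> iff \<open>1, \<dots>, J - 1\<close> all occur there. Counting with the condition "at least \<open>J\<close>" instead
  of "equal to \<open>J\<close>" gives \<open>(N - J)! / (k - J)!\<close> for permutations with \<open>N\<close> among the first \<open>k\<close>
  entries, and that number times \<open>1/(k - J + 1) + \<dots> + 1/(N - J)\<close> for rejectable ones, when \<open>J \<le> j\<close>
  (and \<open>0\<close> otherwise). Both follow by downward induction on \<open>k\<close>, splitting by the relative rank of
  entry \<open>k + 1\<close>. So \<open>\<sigma>\<close> and \<open>\<tau>\<close> are differences of these tails in \<open>J\<close>, while \<open>N! R\<^sub>J\<close> is a partial
  sum of the \<open>(N choose h) \<cdot> R_dot I (h + 1)\<close>, and summation by parts gives the identities.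
\<close>

subsection \<open>Flattening\<close>

text \<open>If \<open>z < x\<close>, then \<open>x\<close> itself is counted in the larger set only;
  otherwise the inclusion of the two sets is reversed. As \<open>z\<close> ranges over all naturals,
  a new entry can be compared with the old ones in \<open>flatten_snoc\<close>.\<close>

lemma card_le_mono:
  fixes A :: "nat set"
  assumes "finite A" "x \<in> A"
  shows "card {y \<in> A. y \<le> z} < card {y \<in> A. y \<le> x} \<longleftrightarrow> z < x"
proof
  assume "z < x"
  then have "{y \<in> A. y \<le> z} \<subseteq> {y \<in> A. y \<le> x}" "x \<in> {y \<in> A. y \<le> x}" "x \<notin> {y \<in> A. y \<le> z}"
    using assms by auto
  then have "{y \<in> A. y \<le> z} \<subset> {y \<in> A. y \<le> x}" by blast
  with assms show "card {y \<in> A. y \<le> z} < card {y \<in> A. y \<le> x}"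
    by (intro psubset_card_mono) auto
next
  assume *: "card {y \<in> A. y \<le> z} < card {y \<in> A. y \<le> x}"
  show "z < x"
  proof (rule ccontr)
    assume "\<not> z < x"
    then have "card {y \<in> A. y \<le> x} \<le> card {y \<in> A. y \<le> z}"
      using assms by (intro card_mono) auto
    with * show False by simp
  qed
qed

text \<open>Ranks are strictly monotone, hence injective on \<open>set s\<close>; an injective image
  inside \<open>{1..length s}\<close> of full cardinality is all of it.\<close>

lemma rank_in_Sym:
  fixes s :: "nat list"
  assumes "distinct s"
  shows "map (\<lambda>x. card {y \<in> set s. y \<le> x}) s \<in> Sym (length s)"
proof -
  let ?r = "\<lambda>x. card {y \<in> set s. y \<le> x}"
  have inj: "inj_on ?r (set s)"
  proof (rule inj_onI)
    fix x y assume "x \<in> set s" "y \<in> set s" and eq: "?r x = ?r y"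
    then show "x = y"
      using card_le_mono[of "set s" x y] card_le_mono[of "set s" y x] by auto
  qed
  have "?r ` set s \<subseteq> {1..length s}"
  proof
    fix r assume "r \<in> ?r ` set s"
    then obtain x where x: "x \<in> set s" "r = ?r x" by auto
    have "1 \<le> ?r x" using x card_gt_0_iff[of "{y \<in> set s. y \<le> x}"] by fastforce
    moreover have "?r x \<le> card (set s)" by (rule card_mono) auto
    ultimately show "r \<in> {1..length s}"
      using x assms by (simp add: distinct_card)
  qed
  moreover have "card (?r ` set s) = card {1..length s}"
    using card_image[OF inj] assms by (simp add: distinct_card)
  ultimately have "?r ` set s = {1..length s}"
    by (intro card_subset_eq) auto
  then show ?thesis
    using inj assms by (intro permutations_of_setI) (auto simp: distinct_map)
qed

text \<open>Counting indices rather than values shows that the comparisons between entries determine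
  the permutation. This gives the uniqueness of the flattening.\<close>

lemma Sym_nth_rank:
  assumes "p \<in> Sym n" "a < n"
  shows "p ! a = card {b. b < n \<and> p ! b \<le> p ! a}"
proof -
  have p: "set p = {1..n}" "distinct p" "length p = n"
    using assms permutations_of_setD[OF assms(1)] distinct_card[of p] by auto
  have "(\<lambda>b. p ! b) ` {b. b < n \<and> p ! b \<le> p ! a} = {y \<in> set p. y \<le> p ! a}"
    using p(3) by (auto simp: in_set_conv_nth)
  moreover have "inj_on (\<lambda>b. p ! b) {b. b < n \<and> p ! b \<le> p ! a}"
    using p by (auto simp: inj_on_def nth_eq_iff_index_eq)
  note card_image[OF this]
  ultimately have "card {b. b < n \<and> p ! b \<le> p ! a} = card {y \<in> set p. y \<le> p ! a}"
    by simp
  moreover have "p ! a \<in> {1..n}" using p assms(2) by (metis nth_mem)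
  then have "{y \<in> set p. y \<le> p ! a} = {1..p ! a}" using p by auto
  ultimately show ?thesis by simp
qed

text \<open>The definite description is resolved by the rank map: existence is
  \<open>rank_in_Sym\<close>, and two permutations with the same comparisons agree by
  \<open>Sym_nth_rank\<close>.\<close>

lemma flatten_eq_rank:
  assumes "distinct s"
  shows "flatten s = map (\<lambda>x. card {y \<in> set s. y \<le> x}) s"
  unfolding flatten_def
proof (rule the_equality, intro conjI allI impI)
  show "map (\<lambda>x. card {y \<in> set s. y \<le> x}) s \<in> Sym (length s)"
    by (rule rank_in_Sym[OF assms])
  fix a b assume "a < length s" "b < length s"
  then show "map (\<lambda>x. card {y \<in> set s. y \<le> x}) s ! a < map (\<lambda>x. card {y \<in> set s. y \<le> x}) s ! b
    \<longleftrightarrow> s ! a < s ! b"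
    by (simp add: card_le_mono)
next
  let ?q = "map (\<lambda>x. card {y \<in> set s. y \<le> x}) s"
  fix p assume p: "p \<in> Sym (length s) \<and>
    (\<forall>a<length s. \<forall>b<length s. p ! a < p ! b \<longleftrightarrow> s ! a < s ! b)"
  have len: "length p = length s"
    using p length_finite_permutations_of_set by fastforce
  show "p = ?q"
  proof (rule nth_equalityI)
    show "length p = length ?q" using len by simp
    fix a assume "a < length p"
    then have a: "a < length s" using len by simp
    have "p ! b \<le> p ! a \<longleftrightarrow> ?q ! b \<le> ?q ! a" if "b < length s" for b
    proof -
      have "p ! a < p ! b \<longleftrightarrow> s ! a < s ! b" using p a that by blast
      also have "\<dots> \<longleftrightarrow> ?q ! a < ?q ! b" using a that by (simp add: card_le_mono)
      finally show ?thesis by linarith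
    qed
    then have "{b. b < length s \<and> p ! b \<le> p ! a} = {b. b < length s \<and> ?q ! b \<le> ?q ! a}"
      by blast
    then show "p ! a = ?q ! a"
      using Sym_nth_rank[of p "length s" a] Sym_nth_rank[OF rank_in_Sym[OF assms] a] p a
      by simp
  qed
qed

lemma Sym_D:
  assumes "p \<in> Sym n"
  shows "set p = {1..n}" "distinct p" "length p = n"
  using permutations_of_setD[OF assms] distinct_card[of p] by auto

lemma flatten_in_Sym: "distinct s \<Longrightarrow> flatten s \<in> Sym (length s)"
  by (simp only: flatten_eq_rank rank_in_Sym)

lemma flatten_Sym:
  assumes "p \<in> Sym n"
  shows "flatten p = p"
proof -
  have "card {y \<in> set p. y \<le> x} = x" if "x \<in> set p" for x
  proof -
    have "{y \<in> set p. y \<le> x} = {1..x}" using that Sym_D[OF assms] by auto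
    then show ?thesis by simp
  qed
  then show ?thesis unfolding flatten_eq_rank[OF Sym_D(2)[OF assms]] by (rule map_idI)
qed

subsection \<open>Extending a prefix by one entry\<close>

definition shift :: "nat \<Rightarrow> nat \<Rightarrow> nat" where
  "shift v x = (if v \<le> x then Suc x else x)"

text \<open>The pattern \<open>p\<close> with a last entry of relative rank \<open>v\<close>
  appended; \<open>shift v\<close> is the increasing map that skips \<open>v\<close>.\<close>

definition ext :: "nat list \<Rightarrow> nat \<Rightarrow> nat list" where
  "ext p v = map (shift v) p @ [v]"

lemma inj_shift: "inj (shift v)"
  by (auto simp: inj_def shift_def split: if_splits)

lemma length_ext [simp]: "length (ext p v) = Suc (length p)"
  by (simp add: ext_def)

lemma ext_eq_iff: "ext p v = ext q w \<longleftrightarrow> p = q \<and> v = w"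
  by (auto simp: ext_def inj_map_eq_map[OF inj_shift])

lemma ext_in_Sym:
  assumes "p \<in> Sym k" "1 \<le> v" "v \<le> Suc k"
  shows "ext p v \<in> Sym (Suc k)"
proof (rule permutations_of_setI)
  have "x \<in> shift v ` {1..k} \<union> {v}" if "1 \<le> x" "x \<le> Suc k" for x
  proof -
    consider "x < v" | "x = v" | "v < x" by linarith
    then show ?thesis
    proof cases
      case 1
      then have "x = shift v x" "x \<in> {1..k}" using that assms by (auto simp: shift_def)
      then show ?thesis by blast
    next
      case 3
      then have "x = shift v (x - 1)" "x - 1 \<in> {1..k}" using that assms by (auto simp: shift_def)
      then show ?thesis by blast
    qed auto
  qed
  then have "{1..Suc k} \<subseteq> shift v ` {1..k} \<union> {v}"
    by (meson atLeastAtMost_iff subsetI)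
  then have "{1..Suc k} \<subseteq> set (ext p v)"
    using Sym_D(1)[OF assms(1)] by (simp add: ext_def)
  moreover have "set (ext p v) \<subseteq> {1..Suc k}"
    using Sym_D(1)[OF assms(1)] assms(2,3) by (auto simp: ext_def shift_def)
  ultimately show "set (ext p v) = {1..Suc k}" by simp
  show "distinct (ext p v)"
    using Sym_D[OF assms(1)] inj_on_subset[OF inj_shift]
    by (auto simp: ext_def distinct_map) (auto simp: shift_def split: if_splits)
qed

text \<open>Appending \<open>a\<close> raises by one exactly the ranks of the entries above
  \<open>a\<close>, and by \<open>card_le_mono\<close> these are the ranks that \<open>shift\<close>
  raises.\<close>

lemma flatten_snoc:
  assumes "distinct (s @ [a])"
  shows "flatten (s @ [a]) = ext (flatten s) (Suc (card {y \<in> set s. y \<le> a}))"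
proof -
  let ?v = "Suc (card {y \<in> set s. y \<le> a})"
  have *: "card {y \<in> set (s @ [a]). y \<le> x} = shift ?v (card {y \<in> set s. y \<le> x})"
    if x: "x \<in> set s" for x
  proof (cases "a < x")
    case True
    then have "{y \<in> set (s @ [a]). y \<le> x} = insert a {y \<in> set s. y \<le> x}" by auto
    then show ?thesis
      using True card_le_mono[of "set s" x a] x assms by (simp add: shift_def)
  next
    case False
    then have "{y \<in> set (s @ [a]). y \<le> x} = {y \<in> set s. y \<le> x}" using x assms by auto
    then show ?thesis
      using False card_le_mono[of "set s" x a] x assms by (simp add: shift_def)
  qed
  have "{y \<in> set (s @ [a]). y \<le> a} = insert a {y \<in> set s. y \<le> a}" by auto
  then have "card {y \<in> set (s @ [a]). y \<le> a} = ?v" using assms by simp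
  with * show ?thesis
    unfolding ext_def flatten_eq_rank[OF assms] using assms
    by (simp add: flatten_eq_rank)
qed

section \<open>Permutations with a given prefix pattern\<close>

definition fibre :: "nat \<Rightarrow> nat list \<Rightarrow> nat list set" where
  "fibre N p = {\<pi> \<in> Sym N. flatten (take (length p) \<pi>) = p}"

lemma finite_fibre [simp]: "finite (fibre N p)"
  by (simp add: fibre_def)

lemma fibre_full:
  assumes "p \<in> Sym N"
  shows "fibre N p = {p}"
proof -
  have "flatten (take (length p) \<pi>) = \<pi>" if "\<pi> \<in> Sym N" for \<pi>
    using flatten_Sym[OF that] Sym_D[OF that] Sym_D[OF assms] by simp
  then show ?thesis using assms by (auto simp: fibre_def)
qed

lemma flatten_take_Suc:
  assumes "\<pi> \<in> Sym N" "k < N"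
  shows "flatten (take (Suc k) \<pi>) =
    ext (flatten (take k \<pi>)) (Suc (card {y \<in> set (take k \<pi>). y \<le> \<pi> ! k}))"
proof -
  have "take (Suc k) \<pi> = take k \<pi> @ [\<pi> ! k]"
    using assms Sym_D[OF assms(1)] by (simp add: take_Suc_conv_app_nth)
  moreover have "distinct (take (Suc k) \<pi>)"
    using Sym_D[OF assms(1)] by (simp add: distinct_take)
  ultimately show ?thesis using flatten_snoc by metis
qed

lemma fibre_ext_D:
  assumes "\<pi> \<in> fibre N (ext p v)" "length p < N"
  shows "\<pi> \<in> fibre N p"
    and "v = Suc (card {y \<in> set (take (length p) \<pi>). y \<le> \<pi> ! length p})"
  using assms flatten_take_Suc[of \<pi> N "length p"] by (auto simp: fibre_def ext_eq_iff)

text \<open>The next entry has exactly one of \<open>k + 1\<close> relative ranks, and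
  \<open>ext\<close> is injective, so the extended fibres partition the fibre. Both counts below
  recurse along this partition.\<close>

lemma card_fibre_split:
  assumes "length p = k" "k < N"
  shows "card {\<pi> \<in> fibre N p. P \<pi>} = (\<Sum>v = 1..Suc k. card {\<pi> \<in> fibre N (ext p v). P \<pi>})"
proof -
  have "{\<pi> \<in> fibre N p. P \<pi>} = (\<Union>v\<in>{1..Suc k}. {\<pi> \<in> fibre N (ext p v). P \<pi>})"
  proof (intro equalityI subsetI)
    fix \<pi> assume \<pi>: "\<pi> \<in> {\<pi> \<in> fibre N p. P \<pi>}"
    define v where "v = Suc (card {y \<in> set (take k \<pi>). y \<le> \<pi> ! k})"
    have "card {y \<in> set (take k \<pi>). y \<le> \<pi> ! k} \<le> card (set (take k \<pi>))"
      by (rule card_mono) auto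
    also have "\<dots> \<le> k" using card_length[of "take k \<pi>"] by simp
    finally have "v \<in> {1..Suc k}" by (simp add: v_def)
    moreover have "\<pi> \<in> fibre N (ext p v)"
      using \<pi> assms flatten_take_Suc[of \<pi> N k] by (auto simp: fibre_def v_def)
    ultimately show "\<pi> \<in> (\<Union>v\<in>{1..Suc k}. {\<pi> \<in> fibre N (ext p v). P \<pi>})"
      using \<pi> by blast
  qed (use fibre_ext_D(1) assms in auto)
  then show ?thesis
    by (simp only:, subst card_UN_disjoint) (auto simp: fibre_def ext_eq_iff)
qed

text \<open>The relative rank is \<open>k + 1\<close> exactly when all \<open>k\<close> earlier
  entries are counted as smaller. Index \<open>k\<close> is the first entry after the
  prefix.\<close>

lemma fibre_ext_max_iff:
  assumes "\<pi> \<in> fibre N (ext p v)" "length p = k" "k < N"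
  shows "v = Suc k \<longleftrightarrow> left_to_right_max \<pi> k"
proof -
  have \<pi>: "\<pi> \<in> Sym N" using assms by (simp add: fibre_def)
  have len: "length (take k \<pi>) = k" using Sym_D[OF \<pi>] assms by simp
  have card: "card (set (take k \<pi>)) = k"
    using Sym_D[OF \<pi>] len by (simp add: distinct_card distinct_take)
  have "v = Suc k \<longleftrightarrow> card {y \<in> set (take k \<pi>). y \<le> \<pi> ! k} = card (set (take k \<pi>))"
    using fibre_ext_D(2)[OF assms(1)] assms card by auto
  also have "\<dots> \<longleftrightarrow> {y \<in> set (take k \<pi>). y \<le> \<pi> ! k} = set (take k \<pi>)"
  proof
    assume "card {y \<in> set (take k \<pi>). y \<le> \<pi> ! k} = card (set (take k \<pi>))"
    then show "{y \<in> set (take k \<pi>). y \<le> \<pi> ! k} = set (take k \<pi>)"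
      by (intro card_subset_eq) auto
  qed simp
  also have "\<dots> \<longleftrightarrow> (\<forall>a<k. \<pi> ! a \<le> \<pi> ! k)"
  proof -
    have "set (take k \<pi>) = (\<lambda>a. \<pi> ! a) ` {..<k}"
      using len by (metis atLeast0LessThan image_cong list.set_map map_nth nth_take set_upt lessThan_iff)
    then show ?thesis by auto
  qed
  also have "\<dots> \<longleftrightarrow> left_to_right_max \<pi> k"
    using Sym_D[OF \<pi>] assms
    by (auto simp: left_to_right_max_def le_less nth_eq_iff_index_eq)
  finally show ?thesis .
qed

subsection \<open>The J-statistic\<close>

text \<open>At the minimum of the tail all smaller values lie among the first \<open>I\<close>
  entries, so it is a bottom-to-top maximum. A tail entry to its left has this smaller value on its
  right, so it is not one.\<close>

lemma J_stat_eq_Min: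
  assumes "\<pi> \<in> Sym n" "I < n"
  shows "J_stat I \<pi> = Min (set (drop I \<pi>))"
proof -
  note \<pi> = Sym_D[OF assms(1)]
  let ?S = "set (drop I \<pi>)"
  have S: "?S = (\<lambda>i. \<pi> ! i) ` {I..<n}"
  proof -
    have "?S = (\<lambda>i. drop I \<pi> ! i) ` {0..<n - I}" using \<pi> by (auto simp: set_conv_nth)
    also have "\<dots> = (\<lambda>i. \<pi> ! (I + i)) ` {0..<n - I}" using \<pi> by simp
    also have "\<dots> = (\<lambda>i. \<pi> ! i) ` ((+) I ` {0..<n - I})" by (simp only: image_image)
    also have "(+) I ` {0..<n - I} = {I..<n}" using assms by simp
    finally show ?thesis .
  qed
  have "Min ?S \<in> ?S" using S assms by (intro Min_in) auto
  then obtain m where m: "I \<le> m" "m < n" "\<pi> ! m = Min ?S" using S by auto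
  have min: "\<pi> ! m \<le> \<pi> ! i" if "I \<le> i" "i < n" for i
    using that S m by auto
  have "(LEAST i. I \<le> i \<and> bottom_to_top_max \<pi> i) = m"
  proof (rule Least_equality)
    show "I \<le> m \<and> bottom_to_top_max \<pi> m"
    proof -
      have "a < m" if "a < n" "\<pi> ! a < \<pi> ! m" for a
        using min[of a] that m by (cases "I \<le> a") auto
      then show ?thesis using m \<pi> by (simp add: bottom_to_top_max_def)
    qed
    fix i assume i: "I \<le> i \<and> bottom_to_top_max \<pi> i"
    show "m \<le> i"
    proof (rule ccontr)
      assume "\<not> m \<le> i"
      then have "\<pi> ! m < \<pi> ! i"
        using min[of i] i m \<pi> nth_eq_iff_index_eq[of \<pi> i m]
        by (auto simp: bottom_to_top_max_def order.order_iff_strict)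
      then show False using i m \<pi> \<open>\<not> m \<le> i\<close> by (auto simp: bottom_to_top_max_def)
    qed
  qed
  then show ?thesis using m by (simp add: J_stat_def)
qed

definition covers :: "nat \<Rightarrow> nat \<Rightarrow> nat list \<Rightarrow> bool" where
  "covers I J \<pi> \<longleftrightarrow> {1..<J} \<subseteq> set (take I \<pi>)"

text \<open>The first \<open>I\<close> entries and the tail partition \<open>{1..n}\<close>, so the
  tail has minimum at least \<open>J\<close> iff every value below \<open>J\<close> lies in
  front.\<close>

lemma le_J_stat_iff:
  assumes "\<pi> \<in> Sym n" "I < n" "J \<le> Suc n"
  shows "J \<le> J_stat I \<pi> \<longleftrightarrow> covers I J \<pi>"
proof -
  note \<pi> = Sym_D[OF assms(1)]
  have "set (take I \<pi>) \<union> set (drop I \<pi>) = {1..n}"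
    using \<pi> by (metis append_take_drop_id set_append)
  moreover have "set (take I \<pi>) \<inter> set (drop I \<pi>) = {}"
    using \<pi> by (simp add: set_take_disj_set_drop_if_distinct)
  moreover have "J \<le> J_stat I \<pi> \<longleftrightarrow> (\<forall>x\<in>set (drop I \<pi>). J \<le> x)"
    using assms \<pi> by (subst J_stat_eq_Min) auto
  moreover have "{1..<J} \<subseteq> {1..n}" using assms(3) by auto
  moreover have "(\<forall>x\<in>D. J \<le> x) \<longleftrightarrow> {1..<J} \<subseteq> T"
    if "T \<union> D = {1..n}" "T \<inter> D = {}" "{1..<J} \<subseteq> {1..n}" for T D
  proof -
    have "1 \<le> x" if "x \<in> D" for x using that \<open>T \<union> D = {1..n}\<close> by auto
    then have "(\<forall>x\<in>D. J \<le> x) \<longleftrightarrow> {1..<J} \<inter> D = {}"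
      unfolding disjoint_iff atLeastLessThan_iff by (meson not_less)
    then show ?thesis using that by blast
  qed
  ultimately show ?thesis by (simp add: covers_def)
qed

text \<open>The \<open>J - 1\<close> covered values must fit into \<open>I\<close>
  positions.\<close>

lemma covers_le:
  assumes "covers I J \<pi>"
  shows "J \<le> Suc I"
proof -
  have "card {1..<J} \<le> card (set (take I \<pi>))"
    using assms by (intro card_mono) (auto simp: covers_def)
  also have "\<dots> \<le> I" using card_length[of "take I \<pi>"] by simp
  finally show ?thesis by simp
qed

text \<open>The new entry lies behind the first \<open>I\<close>. If \<open>v < J\<close>, the value
  \<open>v\<close> is therefore missing in front; if \<open>J \<le> v\<close>, shifting does not
  touch the values below \<open>J\<close>.\<close>

lemma covers_ext:
  assumes "p \<in> Sym k" "I \<le> k" "1 \<le> v"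
  shows "covers I J (ext p v) \<longleftrightarrow> covers I J p \<and> J \<le> v"
proof -
  have take: "set (take I (ext p v)) = shift v ` set (take I p)"
    using Sym_D[OF assms(1)] assms(2) by (simp add: ext_def take_map)
  show ?thesis
  proof
    assume c: "covers I J (ext p v)"
    have "v \<notin> shift v ` set (take I p)" by (auto simp: shift_def split: if_splits)
    then have "J \<le> v" using c assms(3) unfolding covers_def take
      by (metis atLeastLessThan_iff not_le subsetD)
    moreover have "x \<in> set (take I p)" if "x \<in> {1..<J}" for x
    proof -
      have "x \<in> shift v ` set (take I p)" using c that by (auto simp: covers_def take)
      then show ?thesis using that \<open>J \<le> v\<close> by (auto simp: shift_def split: if_splits)
    qed
    ultimately show "covers I J p \<and> J \<le> v" by (auto simp: covers_def)
  next
    assume c: "covers I J p \<and> J \<le> v"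
    have "x \<in> shift v ` set (take I p)" if "x \<in> {1..<J}" for x
    proof -
      have "x = shift v x" using that c by (simp add: shift_def)
      then show ?thesis using that c by (auto simp: covers_def)
    qed
    then show "covers I J (ext p v)" by (auto simp: covers_def take)
  qed
qed

subsection \<open>Counting acceptable and rejectable permutations\<close>

lemma max_at_left_to_right_max:
  assumes "\<pi> \<in> Sym N" "k < N" "left_to_right_max \<pi> k"
  shows "N \<notin> set (take k \<pi>)"
proof
  assume "N \<in> set (take k \<pi>)"
  then obtain a where "a < k" "\<pi> ! a = N"
    using Sym_D[OF assms(1)] by (auto simp: in_set_conv_nth)
  then have "N < \<pi> ! k" using assms(3) by (auto simp: left_to_right_max_def)
  moreover have "\<pi> ! k \<in> {1..N}" using Sym_D[OF assms(1)] assms(2) by (metis nth_mem)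
  ultimately show False by simp
qed

text \<open>The value \<open>N\<close> exceeds all other entries, so it is a left-to-right maximum
  wherever it stands.\<close>

lemma not_left_to_right_max_not_max:
  assumes "\<pi> \<in> Sym N" "k < N" "\<not> left_to_right_max \<pi> k"
  shows "\<pi> ! k \<noteq> N"
proof
  note \<pi> = Sym_D[OF assms(1)]
  assume k: "\<pi> ! k = N"
  have "\<pi> ! a < N" if "a < k" for a
  proof -
    have "\<pi> ! a \<in> {1..N}" using \<pi> assms that by (metis nth_mem less_trans)
    moreover have "\<pi> ! a \<noteq> \<pi> ! k" using \<pi> assms that by (simp add: nth_eq_iff_index_eq)
    ultimately show ?thesis using k by simp
  qed
  then show False using assms \<pi> k by (simp add: left_to_right_max_def)
qed

text \<open>Evaluates the sum over the ranks \<open>v \<le> k\<close> of a next entry that is not a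
  new maximum; by \<open>covers_ext\<close> only those with \<open>J \<le> v\<close>
  contribute.\<close>

lemma sum_if_ge:
  fixes c :: real
  assumes "1 \<le> J" "J \<le> Suc k"
  shows "(\<Sum>v = 1..k. if J \<le> v then c else 0) = real (Suc k - J) * c"
proof -
  have "(\<Sum>v = 1..k. if J \<le> v then c else 0) = (\<Sum>v\<in>{v \<in> {1..k}. J \<le> v}. c)"
    by (rule sum.inter_filter[symmetric]) simp
  also have "{v \<in> {1..k}. J \<le> v} = {J..k}" using assms by auto
  finally show ?thesis by simp
qed

text \<open>A new record as next entry keeps \<open>N\<close> out of the first \<open>k\<close> positions; any other next
  entry leaves the condition as it is.\<close>

lemma card_max_in_prefix:
  assumes "k \<le> N" "I < k" "1 \<le> J" "p \<in> Sym k"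
  shows "real (card {\<pi> \<in> fibre N p. covers I J \<pi> \<and> N \<in> set (take k \<pi>)}) =
    (if covers I J p then fact (N - J) / fact (k - J) else 0)"
  using assms
proof (induction k arbitrary: p rule: inc_induct)
  case base
  have "N \<in> set (take N p)" using Sym_D[OF base(3)] base by simp
  then have "{\<pi> \<in> fibre N p. covers I J \<pi> \<and> N \<in> set (take N \<pi>)} = (if covers I J p then {p} else {})"
    using fibre_full[OF base(3)] by auto
  then show ?case by simp
next
  case (step k)
  let ?A = "\<lambda>v. {\<pi> \<in> fibre N (ext p v). covers I J \<pi> \<and> N \<in> set (take k \<pi>)}"
  have len: "length p = k" using Sym_D[OF step(6)] by simp
  have top: "?A (Suc k) = {}"
    using fibre_ext_max_iff[OF _ len step(2)] max_at_left_to_right_max[OF _ step(2)]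
    by (auto simp: fibre_def)
  have ext: "real (card (?A v)) =
      (if J \<le> v then if covers I J p then fact (N - J) / fact (Suc k - J) else 0 else 0)"
    if v: "v \<in> {1..k}" for v
  proof -
    have "N \<in> set (take k \<pi>) \<longleftrightarrow> N \<in> set (take (Suc k) \<pi>)" if "\<pi> \<in> fibre N (ext p v)" for \<pi>
    proof -
      have \<pi>: "\<pi> \<in> Sym N" using that by (simp add: fibre_def)
      have "\<pi> ! k \<noteq> N"
        using not_left_to_right_max_not_max[OF \<pi> step(2)] fibre_ext_max_iff[OF that len step(2)] v
        by auto
      then show ?thesis
        using Sym_D[OF \<pi>] step(2) by (simp add: take_Suc_conv_app_nth)
    qed
    then have "?A v = {\<pi> \<in> fibre N (ext p v). covers I J \<pi> \<and> N \<in> set (take (Suc k) \<pi>)}" by auto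
    then show ?thesis
      using step.IH[of "ext p v"] step.prems v ext_in_Sym[OF step(6), of v]
        covers_ext[OF step(6), of I v J] by simp
  qed
  have "real (card {\<pi> \<in> fibre N p. covers I J \<pi> \<and> N \<in> set (take k \<pi>)}) = (\<Sum>v = 1..k. real (card (?A v)))"
    using card_fibre_split[OF len step(2), of "\<lambda>\<pi>. covers I J \<pi> \<and> N \<in> set (take k \<pi>)"] top by simp
  also have "\<dots> = (\<Sum>v = 1..k. if J \<le> v then if covers I J p then fact (N - J) / fact (Suc k - J) else 0 else 0)"
    by (rule sum.cong) (use ext in auto)
  also have "\<dots> = (if covers I J p then fact (N - J) / fact (k - J) else 0)"
  proof (cases "covers I J p")
    case True
    \<comment> \<open>Since \<open>J \<le> I + 1 \<le> k\<close>, the subtractions are exact, and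
      the factor \<open>k + 1 - J\<close> from the sum turns \<open>fact (Suc k - J)\<close> into
      \<open>fact (k - J)\<close>.\<close>
    then have "J \<le> k" using covers_le[OF True] step.prems by simp
    then show ?thesis
      using True step.prems by (subst sum_if_ge) (auto simp: Suc_diff_le)
  qed simp
  finally show ?case .
qed

text \<open>The next entry is neither \<open>N\<close> nor a left-to-right maximum, so whether the
  search for \<open>N\<close> starts at \<open>k\<close> or at \<open>k + 1\<close> makes no
  difference.\<close>

lemma rejectable_ext_iff:
  assumes "\<pi> \<in> fibre N (ext p v)" "length p = k" "k < N" "v \<noteq> Suc k"
  shows "rejectable N p \<pi> \<longleftrightarrow> rejectable N (ext p v) \<pi>"
proof -
  have \<pi>: "\<pi> \<in> Sym N" using assms by (simp add: fibre_def)
  have nm: "\<not> left_to_right_max \<pi> k" using fibre_ext_max_iff[OF assms(1-3)] assms(4) by simp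
  then have ne: "\<pi> ! k \<noteq> N" using not_left_to_right_max_not_max[OF \<pi> assms(3)] by simp
  have "k \<le> m \<and> \<pi> ! m = N \<and> (\<forall>i. k \<le> i \<and> i < m \<longrightarrow> \<not> left_to_right_max \<pi> i) \<longleftrightarrow>
    Suc k \<le> m \<and> \<pi> ! m = N \<and> (\<forall>i. Suc k \<le> i \<and> i < m \<longrightarrow> \<not> left_to_right_max \<pi> i)" for m
  proof -
    have "k \<le> i \<and> i < m \<longrightarrow> \<not> left_to_right_max \<pi> i"
      if "Suc k \<le> i \<and> i < m \<longrightarrow> \<not> left_to_right_max \<pi> i" for i
      using that nm by (cases "i = k") auto
    then show ?thesis using ne by (cases "m = k") auto
  qed
  then show ?thesis
    using assms fibre_ext_D(1)[OF assms(1)] unfolding rejectable_def by (simp add: fibre_def)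
qed

text \<open>A left-to-right maximum right after the prefix rules out rejection unless it is
  \<open>N\<close> itself. The right-hand side has the form counted by
  \<open>card_max_in_prefix\<close>.\<close>

lemma rejectable_ext_top_iff:
  assumes "\<pi> \<in> fibre N (ext p (Suc k))" "length p = k" "k < N"
  shows "rejectable N p \<pi> \<longleftrightarrow> N \<in> set (take (Suc k) \<pi>)"
proof -
  have \<pi>: "\<pi> \<in> Sym N" using assms by (simp add: fibre_def)
  have max: "left_to_right_max \<pi> k" using fibre_ext_max_iff[OF assms] by simp
  have "N \<in> set (take (Suc k) \<pi>) \<longleftrightarrow> \<pi> ! k = N"
    using max_at_left_to_right_max[OF \<pi> assms(3) max] Sym_D[OF \<pi>] assms(3)
    by (auto simp: take_Suc_conv_app_nth)
  moreover have "(\<exists>m<N. k \<le> m \<and> \<pi> ! m = N \<and> (\<forall>i. k \<le> i \<and> i < m \<longrightarrow> \<not> left_to_right_max \<pi> i)) \<longleftrightarrow> \<pi> ! k = N"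
  proof
    assume "\<exists>m<N. k \<le> m \<and> \<pi> ! m = N \<and> (\<forall>i. k \<le> i \<and> i < m \<longrightarrow> \<not> left_to_right_max \<pi> i)"
    then obtain m where m: "k \<le> m" "\<pi> ! m = N" "\<forall>i. k \<le> i \<and> i < m \<longrightarrow> \<not> left_to_right_max \<pi> i"
      by auto
    then have "m = k" using max by (cases "k < m") auto
    then show "\<pi> ! k = N" using m by simp
  qed (use assms(3) in auto)
  ultimately show ?thesis
    using assms fibre_ext_D(1)[OF assms(1)] unfolding rejectable_def by (simp add: fibre_def)
qed

text \<open>A next entry that is a new maximum contributes a count from
  \<open>card_max_in_prefix\<close>, any other one the same count for a longer prefix. After
  division by \<open>(N - J)! / (k - J)!\<close> the recursion is
  \<open>H k = 1 / (k + 1 - J) + H (k + 1)\<close>, with an empty sum at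
  \<open>k = N\<close>.\<close>

lemma card_rejectable:
  assumes "k \<le> N" "I < k" "1 \<le> J" "p \<in> Sym k"
  shows "real (card {\<pi> \<in> fibre N p. covers I J \<pi> \<and> rejectable N p \<pi>}) =
    (if covers I J p then fact (N - J) / fact (k - J) * (\<Sum>i = k - J + 1..N - J. 1 / real i) else 0)"
  using assms
proof (induction k arbitrary: p rule: inc_induct)
  case base
  have "\<not> rejectable N p \<pi>" for \<pi> using Sym_D[OF base(3)] by (simp add: rejectable_def)
  then show ?case by simp
next
  case (step k)
  let ?B = "\<lambda>v. {\<pi> \<in> fibre N (ext p v). covers I J \<pi> \<and> rejectable N p \<pi>}"
  let ?H = "\<lambda>k. \<Sum>i = k - J + 1..N - J. 1 / real i"
  have len: "length p = k" using Sym_D[OF step(6)] by simp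
  have "?B (Suc k) = {\<pi> \<in> fibre N (ext p (Suc k)). covers I J \<pi> \<and> N \<in> set (take (Suc k) \<pi>)}"
    using rejectable_ext_top_iff[OF _ len step(2)] by auto
  \<comment> \<open>Rank \<open>k + 1\<close> never destroys coverage, because coverage forces
    \<open>J \<le> I + 1 \<le> k\<close>.\<close>
  moreover have "covers I J (ext p (Suc k)) \<longleftrightarrow> covers I J p"
    using covers_ext[OF step(6), of I "Suc k" J] covers_le[of I J p] step.prems by auto
  moreover have "ext p (Suc k) \<in> Sym (Suc k)" "I < Suc k" "Suc k \<le> N"
    using ext_in_Sym[OF step(6)] step.prems step(2) by auto
  ultimately have top: "real (card (?B (Suc k))) =
      (if covers I J p then fact (N - J) / fact (Suc k - J) else 0)"
    using card_max_in_prefix[of "Suc k" N I J "ext p (Suc k)"] step.prems(2) by presburger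
  have ext: "real (card (?B v)) =
      (if J \<le> v then if covers I J p then fact (N - J) / fact (Suc k - J) * ?H (Suc k) else 0 else 0)"
    if v: "v \<in> {1..k}" for v
  proof -
    have "?B v = {\<pi> \<in> fibre N (ext p v). covers I J \<pi> \<and> rejectable N (ext p v) \<pi>}"
      using rejectable_ext_iff[OF _ len step(2)] v by auto
    moreover have "covers I J (ext p v) \<longleftrightarrow> covers I J p \<and> J \<le> v"
      using covers_ext[OF step(6)] step.prems v by simp
    moreover have "ext p v \<in> Sym (Suc k)" "I < Suc k"
      using ext_in_Sym[OF step(6)] step.prems v by auto
    ultimately show ?thesis using step.IH[of "ext p v"] step.prems(2) by presburger
  qed
  have "real (card {\<pi> \<in> fibre N p. covers I J \<pi> \<and> rejectable N p \<pi>}) =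
      (\<Sum>v = 1..k. real (card (?B v))) + real (card (?B (Suc k)))"
    using card_fibre_split[OF len step(2), of "\<lambda>\<pi>. covers I J \<pi> \<and> rejectable N p \<pi>"] by simp
  also have "(\<Sum>v = 1..k. real (card (?B v))) = (\<Sum>v = 1..k. if J \<le> v then
      if covers I J p then fact (N - J) / fact (Suc k - J) * ?H (Suc k) else 0 else 0)"
    by (rule sum.cong) (use ext in auto)
  also have "\<dots> + real (card (?B (Suc k))) =
      (if covers I J p then fact (N - J) / fact (k - J) * ?H k else 0)"
  proof (cases "covers I J p")
    case True
    then have J: "J \<le> k" using covers_le[OF True] step.prems by simp
    \<comment> \<open>Used with \<open>c = k + 1 - J\<close>, \<open>f = (k - J)!\<close>,
      \<open>F = (N - J)!\<close> and \<open>h\<close> the harmonic sum for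
      \<open>k + 1\<close>.\<close>
    have rec: "c * (F / (c * f) * h) + F / (c * f) = F / f * (1 / c + h)"
      if "c \<noteq> 0" "f \<noteq> 0" for c f F h :: real
      using that by (simp add: field_simps)
    have "?H k = 1 / real (Suc k - J) + ?H (Suc k)"
      using J step(2) by (simp add: sum.atLeast_Suc_atMost Suc_diff_le)
    moreover have "(fact (Suc k - J) :: real) = real (Suc k - J) * fact (k - J)"
      using J by (simp add: Suc_diff_le)
    moreover have "real (Suc k - J) \<noteq> 0" using J by simp
    ultimately have "real (Suc k - J) * (fact (N - J) / fact (Suc k - J) * ?H (Suc k)) +
        fact (N - J) / fact (Suc k - J) = fact (N - J) / fact (k - J) * ?H k"
      using rec[of "real (Suc k - J)" "fact (k - J)" "fact (N - J)" "?H (Suc k)"]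
      by (simp only: fact_nonzero not_False_eq_True)
    moreover have "J \<le> Suc k" using J by simp
    ultimately show ?thesis
      unfolding top sum_if_ge[OF step.prems(2) \<open>J \<le> Suc k\<close>] by (simp only: True if_True)
  qed (simp add: top)
  finally show ?case .
qed

subsection \<open>The values of sigma and tau\<close>

text \<open>The count of acceptable permutations with J-statistic at least \<open>J\<close>. The
  cut-off at \<open>j\<close> arises because coverage of \<open>\<pi>\<close> requires coverage by
  the prefix.\<close>

definition sigma_tail :: "nat \<Rightarrow> nat \<Rightarrow> nat \<Rightarrow> nat \<Rightarrow> real" where
  "sigma_tail N k j J = (if J \<le> j then fact (N - J) / fact (k - J) else 0)"

definition tau_tail :: "nat \<Rightarrow> nat \<Rightarrow> nat \<Rightarrow> nat \<Rightarrow> real" where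
  "tau_tail N k j J = sigma_tail N k j J * (\<Sum>i = k - J + 1..N - J. 1 / real i)"

text \<open>Since \<open>p\<close> ends in its largest value, the last of the first \<open>k\<close>
  entries of \<open>\<pi>\<close> is their maximum, so it is \<open>N\<close> as soon as
  \<open>N\<close> occurs among them.\<close>

lemma acceptable_iff:
  assumes "p \<in> Sym k" "last p = k" "1 \<le> k" "k \<le> N" "\<pi> \<in> Sym N"
  shows "acceptable N p \<pi> \<longleftrightarrow> \<pi> \<in> fibre N p \<and> N \<in> set (take k \<pi>)"
proof -
  note \<pi> = Sym_D[OF assms(5)]
  have len: "length p = k" using Sym_D[OF assms(1)] by simp
  let ?s = "take k \<pi>"
  have s: "distinct ?s" "length ?s = k" "?s \<noteq> []" using \<pi> assms by (auto simp: distinct_take)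
  have last: "last ?s = \<pi> ! (k - 1)" using s assms by (simp add: last_conv_nth)
  have "\<pi> ! (k - 1) = N \<longleftrightarrow> N \<in> set ?s" if "flatten ?s = p"
  proof
    assume "\<pi> ! (k - 1) = N"
    then show "N \<in> set ?s" using last s by (metis last_in_set)
  next
    assume N: "N \<in> set ?s"
    have "card {y \<in> set ?s. y \<le> last ?s} = k"
      using assms(2) unfolding that[symmetric] flatten_eq_rank[OF s(1)] by (simp only: last_map[OF s(3)])
    then have "{y \<in> set ?s. y \<le> last ?s} = set ?s"
      using s by (intro card_subset_eq) (auto simp: distinct_card)
    then have "N \<le> \<pi> ! (k - 1)" using N last by auto
    moreover have "\<pi> ! (k - 1) \<in> {1..N}" using \<pi> assms by (metis last last_in_set s(3) in_set_takeD)
    ultimately show "\<pi> ! (k - 1) = N" by simp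
  qed
  then show ?thesis using len assms by (auto simp: acceptable_def fibre_def)
qed

text \<open>The sets for \<open>J\<close> and \<open>J + 1\<close> are nested, so their difference
  has the difference of the cardinalities.\<close>

lemma card_J_stat_eq:
  assumes "I < N" "J \<le> Suc I"
  shows "real (card {\<pi> \<in> Sym N. J_stat I \<pi> = J \<and> P \<pi>}) =
    real (card {\<pi> \<in> Sym N. covers I J \<pi> \<and> P \<pi>}) -
    real (card {\<pi> \<in> Sym N. covers I (Suc J) \<pi> \<and> P \<pi>})"
proof -
  let ?C = "\<lambda>J. {\<pi> \<in> Sym N. covers I J \<pi> \<and> P \<pi>}"
  have "J_stat I \<pi> = J \<longleftrightarrow> covers I J \<pi> \<and> \<not> covers I (Suc J) \<pi>" if "\<pi> \<in> Sym N" for \<pi>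
    using le_J_stat_iff[OF that assms(1), of J] le_J_stat_iff[OF that assms(1), of "Suc J"] assms
    by linarith
  then have "{\<pi> \<in> Sym N. J_stat I \<pi> = J \<and> P \<pi>} = ?C J - ?C (Suc J)" by blast
  moreover have "?C (Suc J) \<subseteq> ?C J" by (auto simp: covers_def)
  moreover have "finite (?C J)" by simp
  ultimately show ?thesis
    by (simp add: card_Diff_subset card_mono finite_subset of_nat_diff)
qed

lemma card_J_acceptable:
  assumes "p \<in> prefixes I k j" "last p = k" "I < k" "k \<le> N" "1 \<le> J" "J \<le> Suc I"
  shows "real (card {\<pi> \<in> Sym N. J_stat I \<pi> = J \<and> acceptable N p \<pi>}) =
    sigma_tail N k j J - sigma_tail N k j (Suc J)"
proof -
  have p: "p \<in> Sym k" "J_stat I p = j" using assms by (auto simp: prefixes_def)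
  have count: "real (card {\<pi> \<in> Sym N. covers I J' \<pi> \<and> acceptable N p \<pi>}) = sigma_tail N k j J'"
    \<comment> \<open>The range reaches \<open>I + 2\<close>, which is needed for the subtracted
      tail when \<open>J = I + 1\<close>.\<close>
    if "1 \<le> J'" "J' \<le> Suc (Suc I)" for J'
  proof -
    have "{\<pi> \<in> Sym N. covers I J' \<pi> \<and> acceptable N p \<pi>} =
        {\<pi> \<in> fibre N p. covers I J' \<pi> \<and> N \<in> set (take k \<pi>)}"
      using acceptable_iff[OF p(1)] assms by (auto simp: fibre_def)
    then show ?thesis
      using card_max_in_prefix[OF assms(4,3) that(1) p(1)] le_J_stat_iff[OF p(1) assms(3), of J']
        p(2) that assms by (auto simp: sigma_tail_def)
  qed
  have "I < N" "1 \<le> J" "J \<le> Suc (Suc I)" "1 \<le> Suc J" "Suc J \<le> Suc (Suc I)" "J \<le> Suc I"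
    using assms by auto
  then show ?thesis by (simp only: card_J_stat_eq count)
qed

lemma card_J_rejectable:
  assumes "p \<in> prefixes I k j" "I < k" "k \<le> N" "1 \<le> J" "J \<le> Suc I"
  shows "real (card {\<pi> \<in> Sym N. J_stat I \<pi> = J \<and> rejectable N p \<pi>}) =
    tau_tail N k j J - tau_tail N k j (Suc J)"
proof -
  have p: "p \<in> Sym k" "J_stat I p = j" using assms by (auto simp: prefixes_def)
  have count: "real (card {\<pi> \<in> Sym N. covers I J' \<pi> \<and> rejectable N p \<pi>}) = tau_tail N k j J'"
    if "1 \<le> J'" "J' \<le> Suc (Suc I)" for J'
  proof -
    have "{\<pi> \<in> Sym N. covers I J' \<pi> \<and> rejectable N p \<pi>} =
        {\<pi> \<in> fibre N p. covers I J' \<pi> \<and> rejectable N p \<pi>}"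
      by (auto simp: fibre_def rejectable_def)
    then show ?thesis
      using card_rejectable[OF assms(3,2) that(1) p(1)] le_J_stat_iff[OF p(1) assms(2), of J']
        p(2) that assms by (auto simp: sigma_tail_def tau_tail_def)
  qed
  have "I < N" "1 \<le> J" "J \<le> Suc (Suc I)" "1 \<le> Suc J" "Suc J \<le> Suc (Suc I)" "J \<le> Suc I"
    using assms by auto
  then show ?thesis by (simp only: card_J_stat_eq count)
qed

text \<open>Nonemptiness makes the described number unique, and equality of the real values makes it
  exist.\<close>

lemma the_common_value:
  assumes "S \<noteq> {}" "\<And>p. p \<in> S \<Longrightarrow> real (f p) = c"
  shows "real (THE n. \<forall>p\<in>S. n = f p) = c"
proof -
  obtain p where p: "p \<in> S" using assms(1) by auto
  have eq: "f q = f p" if "q \<in> S" for q using assms(2)[OF that] assms(2)[OF p] by linarith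
  have "(THE n. \<forall>p\<in>S. n = f p) = f p"
  proof (rule the_equality)
    show "\<forall>q\<in>S. f p = f q" using eq by simp
    show "n = f p" if "\<forall>q\<in>S. n = f q" for n using that p by (rule bspec)
  qed
  then show ?thesis using assms(2)[OF p] by simp
qed

section \<open>Existence of prefixes and the resulting values\<close>

lemma prefixesI:
  assumes "p \<in> Sym k" "I < k" "1 \<le> j" "j \<le> Suc I" "{1..<j} \<subseteq> set (take I p)" "j \<notin> set (take I p)"
  shows "p \<in> prefixes I k j"
proof -
  have "j \<le> J_stat I p" "\<not> Suc j \<le> J_stat I p"
    using le_J_stat_iff[OF assms(1,2), of j] le_J_stat_iff[OF assms(1,2), of "Suc j"] assms
    by (auto simp: covers_def subset_iff)
  then show ?thesis using assms(1) by (simp add: prefixes_def)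
qed

lemma prefixes_nonempty:
  assumes "I < k" "1 \<le> j" "j \<le> Suc I"
  shows "prefixes I k j \<noteq> {}"
proof -
  \<comment> \<open>All values except \<open>j\<close> in increasing order; appending
    \<open>j\<close> puts it behind the first \<open>I\<close> entries, which contain
    \<open>1, ..., j - 1\<close>.\<close>
  let ?q = "[1..<j] @ [Suc j..<Suc k]"
  have "{1..<j} \<subseteq> set (take I ?q)" using assms by (auto simp: take_upt)
  moreover have "j \<notin> set (take I ?q)" by (auto dest: in_set_takeD)
  moreover have "take I (?q @ [j]) = take I ?q" using assms by simp
  moreover have "?q @ [j] \<in> Sym k" using assms by (intro permutations_of_setI) auto
  ultimately have "?q @ [j] \<in> prefixes I k j" using assms by (intro prefixesI) auto
  then show ?thesis by blast
qed

text \<open>For \<open>k = I + 1\<close> the tail is a single entry, which is both the J-statistic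
  and the last value, so only \<open>j = k\<close> is possible. For larger \<open>k\<close> there is
  room for \<open>j\<close> directly before \<open>k\<close>.\<close>

lemma prefixes_last_nonempty:
  assumes "I < k" "1 \<le> j" "j \<le> Suc I" "\<not> (k = Suc I \<and> j \<le> I)"
  shows "{p \<in> prefixes I k j. last p = k} \<noteq> {}"
proof (cases "k = Suc I")
  case True
  then have j: "j = k" using assms by simp
  have "[1..<Suc k] \<in> prefixes I k j"
    using True j by (intro prefixesI permutations_of_setI) (auto simp: take_upt)
  moreover have "last [1..<Suc k] = k" using True by simp
  ultimately show ?thesis by blast
next
  case False
  let ?q = "[1..<j] @ [Suc j..<k]"
  have "{1..<j} \<subseteq> set (take I ?q)" using assms by (auto simp: take_upt)
  moreover have "j \<notin> set (take I ?q)" by (auto dest: in_set_takeD)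
  moreover have "take I (?q @ [j, k]) = take I ?q" using assms False by simp
  moreover have "?q @ [j, k] \<in> Sym k" using assms False by (intro permutations_of_setI) auto
  ultimately have "?q @ [j, k] \<in> prefixes I k j" using assms by (intro prefixesI) auto
  then show ?thesis by force
qed

text \<open>Where no prefix exists, the conventional values are checked to be the same differences
  of tails; elsewhere the count applies.\<close>

lemma sigma_eq:
  assumes "I < k" "k \<le> N" "1 \<le> j" "j \<le> Suc I" "1 \<le> J" "J \<le> Suc I"
  shows "sigma N I J k j = sigma_tail N k j J - sigma_tail N k j (Suc J)"
proof (cases "k = Suc I \<and> j \<le> I")
  case True
  show ?thesis
  proof (cases "J < j")
    case J: True
    \<comment> \<open>Writing \<open>k = J + a + 1\<close> and \<open>N = k + b\<close> removes
      truncated subtraction. The identity below is then \<open>b = (a + b + 1) - (a + 1)\<close>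
      times \<open>(a + b)! / (a + 1)!\<close>.\<close>
    obtain a where a: "k = Suc (J + a)" using J True less_imp_Suc_add[of J k] by auto
    obtain b where b: "N = k + b" using assms le_Suc_ex by blast
    have diffs: "k - J = Suc a" "k - Suc J = a" "N - J = Suc (a + b)" "N - Suc J = a + b" "N - k = b"
      using a b by auto
    have "real b * fact (a + b) / fact (Suc a) = fact (Suc (a + b)) / fact (Suc a) - (fact (a + b) / fact a :: real)"
      by (simp add: divide_simps) (simp add: algebra_simps)
    moreover have "sigma N I J k j = real (N - k) * fact (N - Suc J) / fact (k - J)"
      using True J by (simp add: sigma_def)
    ultimately show ?thesis
      using J by (simp add: sigma_tail_def diffs del: fact_Suc)
  qed (use True in \<open>auto simp: sigma_def sigma_tail_def\<close>)
next
  case False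
  then show ?thesis
    unfolding sigma_def
    using the_common_value[OF prefixes_last_nonempty[OF assms(1,3,4)],
        of "\<lambda>p. card {\<pi> \<in> Sym N. J_stat I \<pi> = J \<and> acceptable N p \<pi>}"
        "sigma_tail N k j J - sigma_tail N k j (Suc J)"] card_J_acceptable[OF _ _ assms(1,2,5,6)]
    by auto
qed

lemma tau_eq:
  assumes "I < k" "k \<le> N" "1 \<le> j" "j \<le> Suc I" "1 \<le> J" "J \<le> Suc I"
  shows "tau N I J k j = tau_tail N k j J - tau_tail N k j (Suc J)"
  unfolding tau_def
  by (rule the_common_value[OF prefixes_nonempty[OF assms(1,3,4)]
        card_J_rejectable[OF _ assms(1,2,5,6)]])

subsection \<open>Summation by parts\<close>

text \<open>As \<open>h \<le> I\<close>, every summand contains the nonzero divisor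
  \<open>(1 - x)^(N - I)\<close>, and cancelling it leaves
  \<open>x^h (1 - x)^(I - h)\<close>.\<close>

lemma R_poly_eq:
  assumes "J \<le> Suc I" "I \<le> N"
  shows "smult (fact N) (R_poly N I J) = (\<Sum>h<J. smult (real (N choose h)) (R_dot I (Suc h)))"
proof -
  have "(\<Sum>h<J. smult (real (N choose h)) ([:0, 1:] ^ h * [:1, -1:] ^ (N - h))) =
      [:1, -1:] ^ (N - I) * (\<Sum>h<J. smult (real (N choose h)) (R_dot I (Suc h)))"
    unfolding sum_distrib_left
  proof (rule sum.cong)
    fix h assume "h \<in> {..<J}"
    then have "N - h = (N - I) + (I - h)" using assms by simp
    then show "smult (real (N choose h)) ([:0, 1:] ^ h * [:1, -1:] ^ (N - h)) =
        [:1, -1:] ^ (N - I) * smult (real (N choose h)) (R_dot I (Suc h))"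
      by (simp add: R_dot_def power_add mult.left_commute)
  qed simp
  then show ?thesis by (simp add: R_poly_def)
qed

text \<open>Abel summation, with the boundary term kept explicit.\<close>

lemma sum_by_parts_smult:
  fixes \<alpha> :: "nat \<Rightarrow> real" and d :: "nat \<Rightarrow> real poly"
  shows "(\<Sum>J = 1..n. smult (\<alpha> J - \<alpha> (Suc J)) (\<Sum>h<J. d h)) =
    (\<Sum>J = 1..n. smult (\<alpha> J) (d (J - 1))) - smult (\<alpha> (Suc n)) (\<Sum>h<n. d h)"
  by (induction n) (auto simp: smult_diff_left smult_add_right algebra_simps)

lemma smult_sum_right: "smult c (sum f A) = (\<Sum>x\<in>A. smult c (f x))"
  by (induction A rule: infinite_finite_induct) (simp_all add: smult_add_right)

text \<open>The partial sums of \<open>R_poly_eq\<close> meet the differences of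
  \<open>\<alpha>\<close>. The boundary term at \<open>I + 2\<close> and the terms with
  \<open>j < J\<close> vanish by the cut-off. A general \<open>\<alpha>\<close> serves both
  identities.\<close>

lemma tail_dot_product:
  fixes \<alpha> s :: "nat \<Rightarrow> real"
  assumes "I \<le> N" "j \<le> Suc I"
    and zero: "\<And>J. j < J \<Longrightarrow> \<alpha> J = 0"
    and s: "\<And>J. 1 \<le> J \<Longrightarrow> J \<le> Suc I \<Longrightarrow> s J = \<alpha> J - \<alpha> (Suc J)"
  shows "(\<Sum>J = 1..j. smult (real (N choose (J - 1)) * \<alpha> J) (R_dot I J)) =
    smult (fact N) (\<Sum>J = 1..I + 1. smult (s J) (R_poly N I J))"
proof -
  let ?d = "\<lambda>h. smult (real (N choose h)) (R_dot I (Suc h))"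
  have "smult (fact N) (\<Sum>J = 1..I + 1. smult (s J) (R_poly N I J)) =
      (\<Sum>J = 1..Suc I. smult (s J) (smult (fact N) (R_poly N I J)))"
    by (simp add: smult_sum_right smult_add_right mult.commute)
  also have "\<dots> = (\<Sum>J = 1..Suc I. smult (\<alpha> J - \<alpha> (Suc J)) (\<Sum>h<J. ?d h))"
    by (rule sum.cong) (use s R_poly_eq assms(1) in auto)
  also have "\<dots> = (\<Sum>J = 1..Suc I. smult (\<alpha> J) (?d (J - 1)))"
    using zero[of "Suc (Suc I)"] assms(2) by (subst sum_by_parts_smult) simp
  also have "\<dots> = (\<Sum>J = 1..j. smult (\<alpha> J) (?d (J - 1)))"
    by (rule sum.mono_neutral_right) (use assms zero in auto)
  also have "\<dots> = (\<Sum>J = 1..j. smult (real (N choose (J - 1)) * \<alpha> J) (R_dot I J))"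
    by (rule sum.cong) (auto simp: mult.commute)
  finally show ?thesis by simp
qed

theorem theorem5p1:
  fixes N I k j :: nat
  assumes "1 \<le> I" and "I < N" and "I < k" and "k \<le> N"
    and "1 \<le> j" and "j \<le> I + 1"
  shows "(\<Sum>J = 1..j. smult (sigma_dot N J k) (R_dot I J)) =
           smult (fact N) (\<Sum>J = 1..I + 1. smult (sigma N I J k j) (R_poly N I J))
       \<and> (\<Sum>J = 1..j. smult (tau_dot N J k) (R_dot I J)) =
           smult (fact N) (\<Sum>J = 1..I + 1. smult (tau N I J k j) (R_poly N I J))"
proof
  \<comment> \<open>For \<open>J \<le> j\<close> the cut-off in the tail is inactive, so
    \<open>sigma_dot\<close> is the tail times \<open>N choose (J - 1)\<close>.\<close>
  have "(\<Sum>J = 1..j. smult (sigma_dot N J k) (R_dot I J)) =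
      (\<Sum>J = 1..j. smult (real (N choose (J - 1)) * sigma_tail N k j J) (R_dot I J))"
    by (rule sum.cong) (auto simp: sigma_dot_def sigma_tail_def)
  also have "\<dots> = smult (fact N) (\<Sum>J = 1..I + 1. smult (sigma N I J k j) (R_poly N I J))"
    by (rule tail_dot_product) (use assms sigma_eq in \<open>auto simp: sigma_tail_def\<close>)
  finally show "(\<Sum>J = 1..j. smult (sigma_dot N J k) (R_dot I J)) =
      smult (fact N) (\<Sum>J = 1..I + 1. smult (sigma N I J k j) (R_poly N I J))" .
next
  have "(\<Sum>J = 1..j. smult (tau_dot N J k) (R_dot I J)) =
      (\<Sum>J = 1..j. smult (real (N choose (J - 1)) * tau_tail N k j J) (R_dot I J))"
    by (rule sum.cong) (auto simp: tau_dot_def sigma_dot_def sigma_tail_def tau_tail_def mult.assoc)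
  also have "\<dots> = smult (fact N) (\<Sum>J = 1..I + 1. smult (tau N I J k j) (R_poly N I J))"
    by (rule tail_dot_product) (use assms tau_eq in \<open>auto simp: sigma_tail_def tau_tail_def\<close>)
  finally show "(\<Sum>J = 1..j. smult (tau_dot N J k) (R_dot I J)) =
      smult (fact N) (\<Sum>J = 1..I + 1. smult (tau N I J k j) (R_poly N I J))" .
qed

end
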